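(* Let $m$ be a positive integer, let $t\ge 0$ be an integer, and let $\{(A_i,B_i)\}_{i=1}^m$ be a collection of pairs of finite sets such that $|A_i|=a_i\le |B_i|=b_i$ for every $1\le i\le m$. Suppose that \begin{itemize} \item $|A_i\cap A_j|>t$ for all $1\le i,j\le m$ (including $i=j$), \item $|A_i\cap B_i|\le t$ for all $1\le i\le m$, \item $|A_i\cap B_j|>t$ for all $1\le i<j\le m$, \item $a_i+b_i=N$ for all $1\le i\le m$ and some positive integer $N$, and $a_1\le a_2\le\cdots\le a_m$. \end{itemize} Then $$\sum_{i=1}^m \binom{N-(2t+1)}{a_i-(t+1)}^{-1}\le 1.$$ *)

theory Defs
  imports Complex_Main
begin

end

theory Submission
  imports Defs "HOL-Combinatorics.Permutations" "HOL-Library.Nat_Bijection" "HOL-Library.Z2"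
    "HOL-Computational_Algebra.Polynomial_Factorial"
begin

text \<open>
  Put \<open>n = N - 2t\<close>. Attach vectors in general position in \<open>k^(n+t)\<close> to the ground elements, take the
  wedge of the vectors of each \<open>A i\<close> and \<open>B i\<close> and contract it with the last \<open>t\<close> coordinates.
  This turns "meets in more than \<open>t\<close> elements" into "has product zero" and "meets in at most
  \<open>t\<close> elements" into "has nonzero product in top degree \<open>n\<close>". Leading monomials of suitably reduced
  elements of the ideals generated by the images of the \<open>A i\<close> form an intersecting antichain of
  sets of sizes \<open>a i - t \<le> n/2\<close> in an \<open>n\<close>-element set, for which Katona's cycle method
  gives the inequality. Working in characteristic 2 removes all signs: the exterior algebra becomes
  the algebra of squarefree polynomials, that is \<open>k[x_0, x_1, ...]\<close> modulo all \<open>x_i^2\<close>.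
\<close>

subsection \<open>Intersecting antichains\<close>

text \<open>A cyclic interval of residues modulo \<open>n\<close>, starting at \<open>p\<close> and
  of length \<open>l\<close>. Over \<open>int\<close> the difference \<open>x - p\<close> may be
  negative, and its residue is still the number of steps from \<open>p\<close> forward to
  \<open>x\<close>.\<close>

definition arc :: "int \<Rightarrow> int \<Rightarrow> int \<Rightarrow> int set" where
  "arc n p l = {x \<in> {0..<n}. (x - p) mod n < l}"

text \<open>Change of origin on the circle: with all offsets taken from one base point, membership
  in an arc becomes a linear inequality with a single case split for wrapping around.\<close>

lemma diff_mod_rebase:
  fixes n x p q :: int
  assumes "0 < n"
  shows "(x - q) mod n =
    (if (q - p) mod n \<le> (x - p) mod n then (x - p) mod n - (q - p) mod n
     else (x - p) mod n - (q - p) mod n + n)"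
proof -
  let ?y = "(x - p) mod n" and ?d = "(q - p) mod n"
  have eq: "(x - q) mod n = (?y - ?d) mod n"
    by (simp add: mod_diff_eq)
  have b: "0 \<le> ?y" "?y < n" "0 \<le> ?d" "?d < n"
    using assms by auto
  show ?thesis
  proof (cases "?d \<le> ?y")
    case True
    then have "(?y - ?d) mod n = ?y - ?d" by (intro mod_pos_pos_trivial) (use b True in linarith)+
    then show ?thesis using True eq by simp
  next
    case False
    have "(?y - ?d) mod n = (?y - ?d + n) mod n" by simp
    also have "\<dots> = ?y - ?d + n" by (intro mod_pos_pos_trivial) (use b False in linarith)+
    finally show ?thesis using False eq by simp
  qed
qed

lemma card_arc:
  assumes "0 \<le> p" "p < n" "0 \<le> l" "l \<le> n"
  shows "card (arc n p l) = nat l"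
proof -
  have "bij_betw (\<lambda>y. (y + p) mod n) {0..<l} (arc n p l)"
  proof (rule bij_betw_byWitness[where f' = "\<lambda>x. (x - p) mod n"])
    show "\<forall>y\<in>{0..<l}. ((y + p) mod n - p) mod n = y"
      using assms by (auto simp: mod_diff_left_eq)
    show "\<forall>x\<in>arc n p l. ((x - p) mod n + p) mod n = x"
      by (auto simp: arc_def mod_add_left_eq)
    show "(\<lambda>y. (y + p) mod n) ` {0..<l} \<subseteq> arc n p l"
      using assms by (auto simp: arc_def mod_diff_left_eq)
    show "(\<lambda>x. (x - p) mod n) ` arc n p l \<subseteq> {0..<l}"
      using assms by (auto simp: arc_def)
  qed
  from bij_betw_same_card[OF this] show ?thesis by simp
qed

text \<open>
  Fix a shortest arc, of length \<open>k\<close>. Every other arc of the family meets it without containing it,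
  so it either starts right of one of the \<open>k - 1\<close> inner cut points or ends at it; two arcs
  attached to the same cut point would be nested or disjoint.
\<close>

lemma sum_inverse_length_arcs_le_1:
  fixes Q :: "(int \<times> 'f) set" and len :: "'f \<Rightarrow> int"
  assumes "0 < n" "finite Q"
    and pos: "\<And>p T. (p, T) \<in> Q \<Longrightarrow> 0 \<le> p \<and> p < n"
    and len: "\<And>p T. (p, T) \<in> Q \<Longrightarrow> 1 \<le> len T \<and> 2 * len T \<le> n"
    and meet: "\<And>p T q U. (p, T) \<in> Q \<Longrightarrow> (q, U) \<in> Q \<Longrightarrow> arc n p (len T) \<inter> arc n q (len U) \<noteq> {}"
    and antichain: "\<And>p T q U. (p, T) \<in> Q \<Longrightarrow> (q, U) \<in> Q \<Longrightarrow>
      arc n p (len T) \<subseteq> arc n q (len U) \<Longrightarrow> T = U"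
  shows "(\<Sum>(p, T)\<in>Q. 1 / real_of_int (len T)) \<le> 1"
proof (cases "Q = {}")
  case False
  have "\<exists>e\<in>Q. \<forall>f\<in>Q. len (snd e) \<le> len (snd f)"
    using arg_min_if_finite[OF \<open>finite Q\<close> False, of "len \<circ> snd"]
    by (metis comp_apply linorder_not_less)
  then obtain p0 T0 where e0: "(p0, T0) \<in> Q" and "\<forall>f\<in>Q. len T0 \<le> len (snd f)" by force
  then have min: "len T0 \<le> len T" if "(p, T) \<in> Q" for p T using that by force
  define k where "k = len T0"
  define off where "off q = (q - p0) mod n" for q
  \<comment> \<open>The point at offset \<open>y\<close> lies in the arc of length \<open>l\<close>
    starting at offset \<open>d\<close>; the second branch counts the steps past the origin.\<close>
  define rel where "rel y d l \<longleftrightarrow> (if d \<le> y then y - d < l else y - d + n < l)" for y d l :: int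
  have off_bound: "0 \<le> off q" "off q < n" for q using \<open>0 < n\<close> by (auto simp: off_def)
  have mem: "x \<in> arc n q l \<longleftrightarrow> rel (off x) (off q) l" if "0 \<le> x" "x < n" for x q l
    using that diff_mod_rebase[OF \<open>0 < n\<close>, of x q p0] by (auto simp: arc_def rel_def off_def)
  have sub: "T = U" if "(p, T) \<in> Q" "(q, U) \<in> Q"
    "\<And>y. 0 \<le> y \<Longrightarrow> y < n \<Longrightarrow> rel y (off p) (len T) \<Longrightarrow> rel y (off q) (len U)" for p q T U
  proof (rule antichain[OF that(1,2)], rule subsetI)
    fix x assume x: "x \<in> arc n p (len T)"
    then have b: "0 \<le> x" "x < n" by (auto simp: arc_def)
    show "x \<in> arc n q (len U)"
      using x that(3)[of "off x"] off_bound[of x] mem[OF b] by auto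
  qed
  have int: "\<exists>y. 0 \<le> y \<and> y < n \<and> rel y (off p) (len T) \<and> rel y (off q) (len U)"
    if PQ: "(p, T) \<in> Q" "(q, U) \<in> Q" for p q T U
  proof -
    obtain x where x: "x \<in> arc n p (len T)" "x \<in> arc n q (len U)" using meet[OF PQ] by auto
    then have b: "0 \<le> x" "x < n" by (auto simp: arc_def)
    show ?thesis
      using x mem[OF b] off_bound[of x] by auto
  qed
  have off_inj: "p = q" if "off p = off q" "(p, T) \<in> Q" "(q, U) \<in> Q" for p q T U
  proof -
    have "(p - q) mod n = 0"
      using that(1) diff_mod_rebase[OF \<open>0 < n\<close>, of p q p0] by (auto simp: off_def)
    moreover have "\<bar>p - q\<bar> < n" using pos[OF that(2)] pos[OF that(3)] by linarith
    ultimately show ?thesis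
      by (metis dvd_imp_le_int abs_of_pos \<open>0 < n\<close> mod_0_imp_dvd not_less eq_iff_diff_eq_0)
  qed
  have off0: "off p0 = 0" by (simp add: off_def)
  have k: "1 \<le> k" "2 * k \<le> n" using len[OF e0] by (auto simp: k_def)
  \<comment> \<open>The cut point of an arc: its start if that lies in the shortest arc, otherwise
    the place where it ends after passing the origin. The value 0 arises only as a start.\<close>
  define \<phi> where "\<phi> = (\<lambda>(q, T). if off q < k then off q else off q + len T - n)"
  have range: "0 \<le> \<phi> (q, T) \<and> \<phi> (q, T) < k \<and> (k \<le> off q \<longrightarrow> 0 < \<phi> (q, T))" if Q: "(q, T) \<in> Q" for q T
  proof (cases "off q < k")
    case True
    then show ?thesis using off_bound by (simp add: \<phi>_def)
  next
    case False
    obtain y where "0 \<le> y" "y < n" "rel y 0 k" "rel y (off q) (len T)"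
      using int[OF e0 Q] off0 k_def by auto
    then have "0 < off q + len T - n" using False by (auto simp: rel_def split: if_splits)
    \<comment> \<open>Otherwise the arc covers the whole shortest arc, so \<open>T = T0\<close> by
      the antichain condition; an arc of length \<open>k\<close> ending at \<open>k\<close> or later
      would need \<open>off q \<ge> n\<close>.\<close>
    moreover have "off q + len T - n < k"
    proof (rule ccontr)
      assume *: "\<not> ?thesis"
      have "T0 = T"
        by (rule sub[OF e0 Q]) (use * False off0 in \<open>auto simp: rel_def k_def\<close>)
      then show False using * off_bound[of q] by (simp add: k_def)
    qed
    ultimately show ?thesis using False by (simp add: \<phi>_def)
  qed
  have inj: "inj_on \<phi> Q"
  proof (rule inj_onI, clarify)
    fix p T q U assume P: "(p, T) \<in> Q" and Q: "(q, U) \<in> Q" and eq: "\<phi> (p, T) = \<phi> (q, U)"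
    have l: "1 \<le> len T" "2 * len T \<le> n" "1 \<le> len U" "2 * len U \<le> n" using len P Q by auto
    obtain y where y: "0 \<le> y" "y < n" "rel y (off p) (len T)" "rel y (off q) (len U)"
      using int[OF P Q] by auto
    \<comment> \<open>Two arcs with a common start or a common end are nested, the shorter inside
      the longer.\<close>
    have TU: "T = U" if "len T \<le> len U \<Longrightarrow> off q \<le> off p \<and> off p + len T \<le> off q + len U"
      "len U \<le> len T \<Longrightarrow> off p \<le> off q \<and> off q + len U \<le> off p + len T"
    proof (cases "len T \<le> len U")
      case True
      show ?thesis by (rule sub[OF P Q]) (use that(1)[OF True] l in \<open>auto simp: rel_def split: if_splits\<close>)
    next
      case False
      then have "len U \<le> len T" by simp
      note * = that(2)[OF this]
      have "U = T" by (rule sub[OF Q P]) (use * l in \<open>auto simp: rel_def split: if_splits\<close>)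
      then show ?thesis by simp
    qed
    consider "off p < k" "off q < k" | "\<not> off p < k" "\<not> off q < k"
      | "off p < k" "\<not> off q < k" | "\<not> off p < k" "off q < k" by blast
    then show "p = q \<and> T = U"
    proof cases
      case 1
      then have "off p = off q" using eq by (simp add: \<phi>_def)
      then show ?thesis using TU off_inj[OF _ P Q] by auto
    next
      case 2
      then have e: "off p + len T = off q + len U" using eq by (simp add: \<phi>_def)
      then have "T = U" using TU by auto
      moreover from this e have "off p = off q" by simp
      ultimately show ?thesis using off_inj[OF _ P Q] by auto
    next
      \<comment> \<open>One arc starts exactly where the other ends. Since both have length at most
        \<open>n / 2\<close>, they cannot meet on the other side of the circle either.\<close>
      case 3
      then have "off p = off q + len U - n" using eq by (simp add: \<phi>_def)
      then have False using y l off_bound[of q] by (auto simp: rel_def split: if_splits)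
      then show ?thesis ..
    next
      case 4
      then have "off q = off p + len T - n" using eq by (simp add: \<phi>_def)
      then have False using y l off_bound[of p] by (auto simp: rel_def split: if_splits)
      then show ?thesis ..
    qed
  qed
  \<comment> \<open>At most \<open>k\<close> arcs, each of weight at most \<open>1 / k\<close>
    because \<open>k\<close> is the smallest length.\<close>
  have "card Q \<le> card {0..<k}"
    by (rule card_inj_on_le[OF inj]) (use range in auto)
  then have card: "real (card Q) \<le> real_of_int k" using k by simp
  have "(\<Sum>(p, T)\<in>Q. 1 / real_of_int (len T)) \<le> (\<Sum>e\<in>Q. 1 / real_of_int k)"
    using min k by (intro sum_mono) (auto simp: k_def intro!: frac_le)
  also have "\<dots> = real (card Q) / real_of_int k" by simp
  also have "\<dots> \<le> 1" using card k by simp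
  finally show ?thesis .
qed simp

section \<open>Averaging over circular arrangements\<close>

lemma exists_permutes_image_eq:
  assumes "finite X" "S \<subseteq> X" "T \<subseteq> X" "card S = card T"
  shows "\<exists>\<sigma>. \<sigma> permutes X \<and> \<sigma> ` S = T"
proof -
  have fin: "finite S" "finite T" using assms finite_subset by auto
  obtain f where f: "bij_betw f S T"
    using finite_same_card_bij[OF fin assms(4)] by auto
  have "card (X - S) = card (X - T)"
    using assms fin by (simp add: card_Diff_subset)
  then obtain g where g: "bij_betw g (X - S) (X - T)"
    using finite_same_card_bij[of "X - S" "X - T"] assms(1) by auto
  define \<sigma> where "\<sigma> x = (if x \<in> S then f x else if x \<in> X then g x else x)" for x
  have 1: "bij_betw \<sigma> S T" using f by (subst bij_betw_cong[of S \<sigma> f]) (auto simp: \<sigma>_def)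
  have 2: "bij_betw \<sigma> (X - S) (X - T)" using g by (subst bij_betw_cong[of "X - S" \<sigma> g]) (auto simp: \<sigma>_def)
  have "bij_betw \<sigma> (S \<union> (X - S)) (T \<union> (X - T))"
    by (rule bij_betw_combine[OF 1 2]) auto
  then have "bij_betw \<sigma> X X" using assms by (simp add: Un_absorb1)
  then have "\<sigma> permutes X"
    by (rule bij_imp_permutes) (use assms in \<open>auto simp: \<sigma>_def\<close>)
  with 1 show ?thesis by (auto simp: bij_betw_def)
qed

text \<open>Composing with a permutation that carries \<open>U\<close> to \<open>V\<close> embeds
  the permutations sending \<open>K\<close> to \<open>U\<close> into those sending \<open>K\<close>
  to \<open>V\<close>. So all these classes have the same size, and together they partition the
  permutations of \<open>X\<close>.\<close>

lemma card_permutes_image_eq: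
  assumes "finite X" "K \<subseteq> X" "T \<subseteq> X" "card K = card T"
  shows "card {\<pi>. \<pi> permutes X \<and> \<pi> ` K = T} * (card X choose card T) = fact (card X)"
proof -
  define c where "c U = {\<pi>. \<pi> permutes X \<and> \<pi> ` K = U}" for U
  let ?F = "{U. U \<subseteq> X \<and> card U = card T}"
  have fin: "finite (c U)" for U
    unfolding c_def using finite_permutations[OF assms(1)] by (rule rev_finite_subset) auto
  have le: "card (c U) = card (c T)" if "U \<in> ?F" for U
  proof -
    have "card (c U) \<le> card (c V)" if UV: "U \<in> ?F" "V \<in> ?F" for U V
    proof -
      obtain \<sigma> where \<sigma>: "\<sigma> permutes X" "\<sigma> ` U = V"
        using exists_permutes_image_eq[OF assms(1), of U V] UV by auto
      show ?thesis
      proof (rule card_inj_on_le[of "\<lambda>\<pi>. \<sigma> \<circ> \<pi>"])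
        show "inj_on (\<lambda>\<pi>. \<sigma> \<circ> \<pi>) (c U)"
          using permutes_inj[OF \<sigma>(1)] by (auto intro!: inj_onI simp: fun_eq_iff inj_eq)
        show "(\<lambda>\<pi>. \<sigma> \<circ> \<pi>) ` c U \<subseteq> c V"
          using \<sigma> by (auto simp: c_def image_comp[symmetric] intro: permutes_compose)
      qed (rule fin)
    qed
    then show ?thesis using that assms by (intro antisym) auto
  qed
  have "fact (card X) = card {\<pi>. \<pi> permutes X}"
    using card_permutations[OF refl assms(1)] by simp
  also have "{\<pi>. \<pi> permutes X} = (\<Union>U\<in>?F. c U)"
  proof -
    have "\<pi> ` K \<subseteq> X \<and> card (\<pi> ` K) = card T" if "\<pi> permutes X" for \<pi>
      using that assms permutes_image[OF that] card_image[OF permutes_inj_on[OF that, of K]] by auto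
    then show ?thesis by (auto simp: c_def)
  qed
  also have "card \<dots> = (\<Sum>U\<in>?F. card (c U))"
    using assms fin by (intro card_UN_disjoint) (auto simp: c_def)
  also have "\<dots> = card ?F * card (c T)" using le by simp
  also have "card ?F = card X choose card T" using n_subsets[OF assms(1)] by simp
  finally show ?thesis by (simp add: c_def mult.commute)
qed

text \<open>Give \<open>T\<close> the weight \<open>1 / card T\<close> each time it appears as an
  arc of a circular arrangement. Every arrangement collects total weight at most 1, while the number
  of arrangements showing \<open>T\<close> at a given place depends only on \<open>card T\<close>;
  double counting gives the bound.\<close>

lemma intersecting_antichain_bound:
  assumes "finite X" "0 < card X" and F: "F \<subseteq> Pow X"
    and half: "\<And>T. T \<in> F \<Longrightarrow> 2 * card T \<le> card X"
    and intersecting: "\<And>S T. S \<in> F \<Longrightarrow> T \<in> F \<Longrightarrow> S \<inter> T \<noteq> {}"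
    and antichain: "\<And>S T. S \<in> F \<Longrightarrow> T \<in> F \<Longrightarrow> S \<subseteq> T \<Longrightarrow> S = T"
  shows "(\<Sum>T\<in>F. inverse (real ((card X - 1) choose (card T - 1)))) \<le> 1"
proof -
  define n where "n = card X"
  have n: "0 < n" using assms by (simp add: n_def)
  have finF: "finite F" using F assms(1) finite_subset by blast
  have finT: "finite T" if "T \<in> F" for T using that F assms(1) finite_subset by blast
  have pos: "1 \<le> card T" if "T \<in> F" for T
    using intersecting[OF that that] finT[OF that] by (simp add: Suc_le_eq card_gt_0_iff)
  obtain e where e: "bij_betw e {0..<int n} X"
    using finite_same_card_bij[of "{0..<int n}" X] assms(1) by (auto simp: n_def)
  define P where "P = {\<pi>. \<pi> permutes X}"
  have finP: "finite P" unfolding P_def by (rule finite_permutations[OF assms(1)])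
  define K where "K p T = e ` arc (int n) p (int (card T))" for p and T :: "'a set"
  have arc_sub: "arc (int n) p l \<subseteq> {0..<int n}" for p l by (auto simp: arc_def)
  have K_sub: "K p T \<subseteq> X" for p T
    using arc_sub e by (auto simp: K_def bij_betw_def)
  have card_K: "card (K p T) = card T" if "p \<in> {0..<int n}" "T \<in> F" for p T
  proof -
    have "inj_on e (arc (int n) p (int (card T)))"
      using e arc_sub by (auto simp: bij_betw_def intro: inj_on_subset)
    then show ?thesis
      using that half[OF that(2)] by (simp add: K_def card_image card_arc n_def)
  qed
  define w where "w T = (1 / real (card T))" for T :: "'a set"
  have circle: "(\<Sum>(p, T)\<in>{0..<int n} \<times> F. if \<pi> ` K p T = T then w T else 0) \<le> 1"
    if "\<pi> \<in> P" for \<pi>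
  proof -
    let ?f = "\<lambda>x. \<pi> (e x)"
    let ?Q = "{(p, T) \<in> {0..<int n} \<times> F. \<pi> ` K p T = T}"
    have inj: "inj_on ?f {0..<int n}"
      using e permutes_inj[of \<pi> X] that unfolding P_def bij_betw_def
      by (auto simp: inj_on_def)
    have im: "T = ?f ` arc (int n) p (int (card T))" if "(p, T) \<in> ?Q" for p T
      using that by (simp add: K_def image_image)
    have finQ: "finite ?Q" using finF by (auto intro: finite_subset[of _ "{0..<int n} \<times> F"])
    have "(\<Sum>(p, T)\<in>{0..<int n} \<times> F. if \<pi> ` K p T = T then w T else 0) = (\<Sum>(p, T)\<in>?Q. w T)"
      using finF
      by (intro sum.mono_neutral_cong_right) (auto simp: case_prod_unfold simp del: image_subset_iff)
    also have "\<dots> = (\<Sum>(p, T)\<in>?Q. 1 / real_of_int (int (card T)))"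
      by (simp add: w_def)
    also have "\<dots> \<le> 1"
    proof (rule sum_inverse_length_arcs_le_1[where n = "int n"])
      show "0 < int n" using n by simp
      show "finite ?Q" by (rule finQ)
      show "0 \<le> p \<and> p < int n" if "(p, T) \<in> ?Q" for p T using that by auto
      show "1 \<le> int (card T) \<and> 2 * int (card T) \<le> int n" if "(p, T) \<in> ?Q" for p T
        using that half[of T] pos[of T] by (auto simp: n_def)
      show "arc (int n) p (int (card T)) \<inter> arc (int n) q (int (card U)) \<noteq> {}"
        if PQ: "(p, T) \<in> ?Q" "(q, U) \<in> ?Q" for p T q U
      proof
        assume *: "arc (int n) p (int (card T)) \<inter> arc (int n) q (int (card U)) = {}"
        have "T \<inter> U = {}"
          using im[OF PQ(1)] im[OF PQ(2)] inj_on_image_Int[OF inj arc_sub arc_sub, of p _ q] *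
          by (metis image_empty)
        then show False using intersecting PQ by auto
      qed
      show "T = U" if PQ: "(p, T) \<in> ?Q" "(q, U) \<in> ?Q"
        and s: "arc (int n) p (int (card T)) \<subseteq> arc (int n) q (int (card U))" for p T q U
      proof (rule antichain)
        show "T \<subseteq> U" using im[OF PQ(1)] im[OF PQ(2)] image_mono[OF s, of ?f] by metis
      qed (use PQ in auto)
    qed
    finally show ?thesis .
  qed
  have count: "(\<Sum>\<pi>\<in>P. if \<pi> ` K p T = T then w T else 0) =
      fact n / real n * inverse (real ((n - 1) choose (card T - 1)))"
    if "p \<in> {0..<int n}" "T \<in> F" for p T
  proof -
    have T: "T \<subseteq> X" using that F by auto
    let ?c = "real (card {\<pi>. \<pi> permutes X \<and> \<pi> ` K p T = T})"
    have c: "?c * real (n choose card T) = fact n"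
      using card_permutes_image_eq[OF assms(1) K_sub T card_K[OF that]]
      by (metis n_def of_nat_fact of_nat_mult)
    \<comment> \<open>This identity is why the weight \<open>1 / card T\<close> turns
      \<open>n choose card T\<close> into the binomial coefficient of the claim.\<close>
    have absorb: "real (card T) * real (n choose card T) = real n * real ((n - 1) choose (card T - 1))"
      using times_binomial_minus1_eq[of "card T" n] pos[OF that(2)]
      by (metis One_nat_def Suc_le_eq of_nat_mult)
    have nz: "0 < n choose card T" using half[OF that(2)] by (simp add: n_def)
    have "(\<Sum>\<pi>\<in>P. if \<pi> ` K p T = T then w T else 0) = ?c * w T"
      using finP by (simp add: sum.If_cases P_def Int_def)
    also have "\<dots> = (?c * real (n choose card T)) / (real (card T) * real (n choose card T))"
      using nz by (simp add: w_def)
    also have "\<dots> = fact n / (real n * real ((n - 1) choose (card T - 1)))"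
      by (simp only: c absorb)
    finally show ?thesis by (simp add: field_simps)
  qed
  \<comment> \<open>The \<open>n\<close> starting points contribute equally, which accounts for the
    factor \<open>1 / n\<close> in \<open>count\<close>.\<close>
  have "fact n * (\<Sum>T\<in>F. inverse (real ((n - 1) choose (card T - 1)))) =
      (\<Sum>p\<in>{0..<int n}. \<Sum>T\<in>F. fact n / real n * inverse (real ((n - 1) choose (card T - 1))))"
    using n by (simp add: sum_distrib_left)
  also have "\<dots> = (\<Sum>(p, T)\<in>{0..<int n} \<times> F. \<Sum>\<pi>\<in>P. if \<pi> ` K p T = T then w T else 0)"
    unfolding sum.cartesian_product by (intro sum.cong) (auto simp: count)
  also have "\<dots> = (\<Sum>\<pi>\<in>P. \<Sum>(p, T)\<in>{0..<int n} \<times> F. if \<pi> ` K p T = T then w T else 0)"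
    unfolding case_prod_unfold by (rule sum.swap)
  also have "\<dots> \<le> (\<Sum>\<pi>\<in>P. 1)"
    by (intro sum_mono circle)
  also have "\<dots> = fact n * 1"
    using card_permutations[OF refl assms(1)] by (simp add: P_def n_def)
  finally show ?thesis
    unfolding n_def[symmetric] by (subst (asm) mult_le_cancel_left_pos) auto
qed

subsection \<open>The algebra of squarefree polynomials\<close>

text \<open>A coefficient function on monomials, a monomial being its set of variables. Infinitely
  many nonzero coefficients are allowed, as a coefficient of a product involves only the finitely
  many subsets of its monomial; infinite sets get 0, which is also the default value of the sum over
  their subsets.\<close>

typedef (overloaded) 'k sqfree = "{f :: nat set \<Rightarrow> 'k::comm_ring_1. \<forall>S. infinite S \<longrightarrow> f S = 0}"
  morphisms sq_coeff Abs_sqfree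
  by (rule exI[of _ "\<lambda>_. 0"]) simp

setup_lifting type_definition_sqfree

lemma sqfree_eqI: "(\<And>S. finite S \<Longrightarrow> sq_coeff x S = sq_coeff y S) \<Longrightarrow> x = y"
  by transfer (metis ext)

lemma sq_coeff_infinite: "infinite S \<Longrightarrow> sq_coeff x S = 0"
  by transfer simp

text \<open>Both sides run over the ordered partitions of \<open>S\<close> into three parts; this is
  associativity of the product.\<close>

lemma sum_Pow_split_assoc:
  assumes "finite S"
  shows "(\<Sum>T\<in>Pow S. \<Sum>U\<in>Pow T. f U (T - U) (S - T)) = (\<Sum>U\<in>Pow S. \<Sum>V\<in>Pow (S - U). f U V (S - U - V))"
proof -
  have fin: "finite T" if "T \<subseteq> S" for T using that assms finite_subset by auto
  have "(\<Sum>T\<in>Pow S. \<Sum>U\<in>Pow T. f U (T - U) (S - T)) = (\<Sum>(T, U)\<in>Sigma (Pow S) Pow. f U (T - U) (S - T))"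
    using assms fin by (intro sum.Sigma) auto
  also have "\<dots> = (\<Sum>(U, V)\<in>Sigma (Pow S) (\<lambda>U. Pow (S - U)). f U V (S - U - V))"
    by (rule sum.reindex_bij_witness[where i = "\<lambda>(U, V). (U \<union> V, U)" and j = "\<lambda>(T, U). (U, T - U)"])
      (auto intro!: arg_cong3[where f = f] arg_cong2[where f = "f _"])
  also have "\<dots> = (\<Sum>U\<in>Pow S. \<Sum>V\<in>Pow (S - U). f U V (S - U - V))"
    using assms fin by (intro sum.Sigma[symmetric]) auto
  finally show ?thesis .
qed

instantiation sqfree :: (comm_ring_1) comm_ring_1
begin

lift_definition zero_sqfree :: "'a sqfree" is "\<lambda>_. 0" by simp
lift_definition one_sqfree :: "'a sqfree" is "\<lambda>S. if S = {} then 1 else 0" by auto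
lift_definition plus_sqfree :: "'a sqfree \<Rightarrow> 'a sqfree \<Rightarrow> 'a sqfree" is "\<lambda>f g S. f S + g S" by auto
lift_definition minus_sqfree :: "'a sqfree \<Rightarrow> 'a sqfree \<Rightarrow> 'a sqfree" is "\<lambda>f g S. f S - g S" by auto
lift_definition uminus_sqfree :: "'a sqfree \<Rightarrow> 'a sqfree" is "\<lambda>f S. - f S" by auto
text \<open>Only disjoint pairs \<open>T\<close>, \<open>S - T\<close> contribute, so a product of
  monomials sharing a variable vanishes: this is the relation that all squares \<open>x_i^2\<close>
  are 0.\<close>

lift_definition times_sqfree :: "'a sqfree \<Rightarrow> 'a sqfree \<Rightarrow> 'a sqfree" is
  "\<lambda>f g S. \<Sum>T\<in>Pow S. f T * g (S - T)" by auto

instance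
proof
  fix x y z :: "'a sqfree"
  show "x * y * z = x * (y * z)"
  proof (rule sqfree_eqI)
    fix S :: "nat set" assume S: "finite S"
    have "sq_coeff (x * y * z) S = (\<Sum>T\<in>Pow S. \<Sum>U\<in>Pow T. sq_coeff x U * sq_coeff y (T - U) * sq_coeff z (S - T))"
      by (simp add: times_sqfree.rep_eq sum_distrib_right)
    also have "\<dots> = (\<Sum>U\<in>Pow S. \<Sum>V\<in>Pow (S - U). sq_coeff x U * sq_coeff y V * sq_coeff z (S - U - V))"
      by (rule sum_Pow_split_assoc[OF S])
    also have "\<dots> = sq_coeff (x * (y * z)) S"
      by (simp add: times_sqfree.rep_eq sum_distrib_left mult.assoc)
    finally show "sq_coeff (x * y * z) S = sq_coeff (x * (y * z)) S" .
  qed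
  show "x * y = y * x"
  proof (rule sqfree_eqI)
    fix S :: "nat set"
    show "sq_coeff (x * y) S = sq_coeff (y * x) S"
      unfolding times_sqfree.rep_eq
      by (rule sum.reindex_bij_witness[where i = "\<lambda>T. S - T" and j = "\<lambda>T. S - T"])
        (auto simp: double_diff mult.commute)
  qed
  show "1 * x = x"
  proof (rule sqfree_eqI)
    fix S :: "nat set" assume S: "finite S"
    have "sq_coeff (1 * x) S = (\<Sum>T\<in>Pow S. if T = {} then sq_coeff x S else 0)"
      unfolding times_sqfree.rep_eq one_sqfree.rep_eq by (intro sum.cong) auto
    then show "sq_coeff (1 * x) S = sq_coeff x S" using S by simp
  qed
  show "(x + y) * z = x * z + y * z"
    by (rule sqfree_eqI) (simp add: times_sqfree.rep_eq plus_sqfree.rep_eq algebra_simps sum.distrib)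
  show "(0::'a sqfree) \<noteq> 1"
    by transfer (metis zero_neq_one)
qed (transfer, simp add: fun_eq_iff algebra_simps)+

end

lemmas sq_coeff_simps [simp] = zero_sqfree.rep_eq plus_sqfree.rep_eq minus_sqfree.rep_eq uminus_sqfree.rep_eq

lemma sq_coeff_times: "sq_coeff (x * y) S = (\<Sum>T\<in>Pow S. sq_coeff x T * sq_coeff y (S - T))"
  by (simp add: times_sqfree.rep_eq)

lemma sq_coeff_sum [simp]: "sq_coeff (sum f A) S = (\<Sum>i\<in>A. sq_coeff (f i) S)"
  by (induction A rule: infinite_finite_induct) auto

lemma sq_coeff_times_nonzeroE:
  assumes "sq_coeff (x * y) S \<noteq> 0"
  obtains T where "T \<subseteq> S" "sq_coeff x T \<noteq> 0" "sq_coeff y (S - T) \<noteq> 0" "finite S"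
proof -
  have "finite S" using assms sq_coeff_infinite by blast
  moreover obtain T where "T \<in> Pow S" "sq_coeff x T * sq_coeff y (S - T) \<noteq> 0"
    using assms unfolding sq_coeff_times by (rule sum.not_neutral_contains_not_neutral)
  ultimately show thesis using that[of T] by (metis PowD mult_zero_left mult_zero_right)
qed

lift_definition sq_term :: "'k::comm_ring_1 \<Rightarrow> nat set \<Rightarrow> 'k sqfree" is
  "\<lambda>c U S. if S = U \<and> finite U then c else 0" by auto

lemma sq_coeff_sq_term: "finite U \<Longrightarrow> sq_coeff (sq_term c U) S = (if S = U then c else 0)"
  by transfer auto

abbreviation const :: "'k::comm_ring_1 \<Rightarrow> 'k sqfree" where "const c \<equiv> sq_term c {}"

lemma sq_coeff_const_times [simp]: "sq_coeff (const c * x) S = c * sq_coeff x S"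
proof (cases "finite S")
  case True
  have "sq_coeff (const c * x) S = (\<Sum>T\<in>Pow S. if T = {} then c * sq_coeff x S else 0)"
    unfolding sq_coeff_times by (intro sum.cong) (auto simp: sq_coeff_sq_term)
  then show ?thesis using True by simp
qed (simp add: sq_coeff_infinite)

lemma const_1 [simp]: "const 1 = 1"
  by (rule sqfree_eqI) (simp add: sq_coeff_sq_term one_sqfree.rep_eq)

lemma sq_term_times_sq_term:
  assumes "finite S" "finite T"
  shows "sq_term c S * sq_term d T = (if S \<inter> T = {} then sq_term (c * d) (S \<union> T) else 0)"
proof (rule sqfree_eqI)
  fix R :: "nat set" assume R: "finite R"
  have "sq_coeff (sq_term c S * sq_term d T) R = (\<Sum>U\<in>Pow R. if U = S then (if R - S = T then c * d else 0) else 0)"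
    unfolding sq_coeff_times by (intro sum.cong) (auto simp: sq_coeff_sq_term assms)
  also have "\<dots> = (if S \<subseteq> R \<and> R - S = T then c * d else 0)" using R by simp
  also have "\<dots> = sq_coeff (if S \<inter> T = {} then sq_term (c * d) (S \<union> T) else 0) R"
    using assms by (auto simp: sq_coeff_sq_term)
  finally show "sq_coeff (sq_term c S * sq_term d T) R = \<dots>" .
qed

section \<open>Homogeneous elements and leading monomials\<close>

definition homogeneous :: "nat \<Rightarrow> nat \<Rightarrow> 'k::comm_ring_1 sqfree \<Rightarrow> bool" where
  "homogeneous n k x \<longleftrightarrow> (\<forall>S. sq_coeff x S \<noteq> 0 \<longrightarrow> S \<subseteq> {..<n} \<and> card S = k)"

lemma homogeneous_add: "homogeneous n k x \<Longrightarrow> homogeneous n k y \<Longrightarrow> homogeneous n k (x + y)"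
  unfolding homogeneous_def by (metis sq_coeff_simps(2) add_0)

lemma homogeneous_0 [simp]: "homogeneous n k 0"
  by (simp add: homogeneous_def)

lemma homogeneous_sum: "(\<And>i. i \<in> A \<Longrightarrow> homogeneous n k (f i)) \<Longrightarrow> homogeneous n k (sum f A)"
  by (induction A rule: infinite_finite_induct) (auto intro: homogeneous_add)

lemma homogeneous_sq_term: "U \<subseteq> {..<n} \<Longrightarrow> homogeneous n (card U) (sq_term c U)"
  using finite_subset[of U "{..<n}"] by (auto simp: homogeneous_def sq_coeff_sq_term)

lemma homogeneous_mult:
  assumes "homogeneous n k x" "homogeneous n l y"
  shows "homogeneous n (k + l) (x * y)"
  unfolding homogeneous_def
proof (intro allI impI)
  fix S assume "sq_coeff (x * y) S \<noteq> 0"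
  then obtain T where T: "T \<subseteq> S" "sq_coeff x T \<noteq> 0" "sq_coeff y (S - T) \<noteq> 0" "finite S"
    by (rule sq_coeff_times_nonzeroE)
  then have "T \<subseteq> {..<n}" "card T = k" "S - T \<subseteq> {..<n}" "card (S - T) = l"
    using assms unfolding homogeneous_def by blast+
  moreover have "card S = card T + card (S - T)"
    using T by (metis card_Diff_subset card_mono finite_subset le_add_diff_inverse)
  ultimately show "S \<subseteq> {..<n} \<and> card S = k + l" by auto
qed

lemma homogeneous_const_mult: "homogeneous n k x \<Longrightarrow> homogeneous n k (const c * x)"
  using homogeneous_mult[OF homogeneous_sq_term[of "{}"]] by force

lemma homogeneous_prod:
  assumes "\<And>i. i \<in> A \<Longrightarrow> homogeneous n 1 (f i)" "finite A"
  shows "homogeneous n (card A) (prod f A)"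
  using assms(2,1)
proof (induction A rule: finite_induct)
  case empty
  show ?case using homogeneous_sq_term[of "{}" n 1] by simp
next
  case (insert a A)
  then show ?case using homogeneous_mult[of n 1 "f a" "card A" "prod f A"] by simp
qed

text \<open>\<open>set_encode\<close> reads a finite set as a binary number. It is injective on
  finite sets and additive on disjoint unions, so it serves as a monomial order. As a relation,
  \<open>lead\<close> leaves 0 without a leading monomial.\<close>

definition lead :: "'k::comm_ring_1 sqfree \<Rightarrow> nat set \<Rightarrow> bool" where
  "lead x S \<longleftrightarrow> sq_coeff x S \<noteq> 0 \<and> (\<forall>T. sq_coeff x T \<noteq> 0 \<longrightarrow> set_encode T \<le> set_encode S)"

lemma lead_finite: "lead x S \<Longrightarrow> finite S"
  using sq_coeff_infinite by (auto simp: lead_def)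

lemma lead_exists:
  assumes "homogeneous n k x" "x \<noteq> 0"
  shows "\<exists>S. lead x S"
proof -
  let ?A = "{S. sq_coeff x S \<noteq> 0}"
  have "?A \<subseteq> Pow {..<n}" using assms(1) by (auto simp: homogeneous_def)
  then have fin: "finite ?A" by (rule finite_subset) simp
  have "?A \<noteq> {}" using assms(2) sqfree_eqI[of x 0] by auto
  then obtain S where "S \<in> ?A" "\<And>T. T \<in> ?A \<Longrightarrow> set_encode T \<le> set_encode S"
    using Max_in[of "set_encode ` ?A"] Max_ge[of "set_encode ` ?A"] fin
    by (smt (verit) finite_imageI image_iff image_is_empty)
  then show ?thesis by (auto simp: lead_def)
qed

lemma set_encode_Un_disjoint:
  "finite S \<Longrightarrow> finite T \<Longrightarrow> S \<inter> T = {} \<Longrightarrow> set_encode (S \<union> T) = set_encode S + set_encode T"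
  by (simp add: set_encode_def sum.union_disjoint)

text \<open>By additivity of the code, a product monomial has code at most that of
  \<open>S \<union> T\<close>, and equality forces both factors to be the leading ones. So the
  coefficient at \<open>S \<union> T\<close> is a single product of nonzero scalars.\<close>

lemma lead_times:
  fixes x y :: "'k::idom sqfree"
  assumes x: "lead x S" and y: "lead y T" and disj: "S \<inter> T = {}"
  shows "lead (x * y) (S \<union> T)"
proof -
  have fin: "finite S" "finite T" using assms lead_finite by auto
  have enc: "set_encode R \<le> set_encode (S \<union> T) \<and> (R = S \<union> T \<longrightarrow> U = S)"
    if U: "U \<subseteq> R" "sq_coeff x U \<noteq> 0" "sq_coeff y (R - U) \<noteq> 0" "finite R" for U R
  proof -
    have finU: "finite U" using U finite_subset by auto
    have "set_encode R = set_encode U + set_encode (R - U)"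
      using set_encode_Un_disjoint[of U "R - U"] U finU by (simp add: Un_absorb1)
    moreover have "set_encode U \<le> set_encode S" "set_encode (R - U) \<le> set_encode T"
      using x y U by (auto simp: lead_def)
    moreover note set_encode_Un_disjoint[OF fin disj]
    ultimately have "set_encode R \<le> set_encode (S \<union> T)" "R = S \<union> T \<longrightarrow> set_encode U = set_encode S"
      by auto
    then show ?thesis using set_encode_eq finU fin by blast
  qed
  have "sq_coeff (x * y) (S \<union> T) = (\<Sum>U\<in>Pow (S \<union> T). if U = S then sq_coeff x S * sq_coeff y T else 0)"
    unfolding sq_coeff_times
  proof (rule sum.cong)
    fix U assume "U \<in> Pow (S \<union> T)"
    moreover have "S \<union> T - S = T" using disj by auto
    ultimately show "sq_coeff x U * sq_coeff y (S \<union> T - U) = (if U = S then sq_coeff x S * sq_coeff y T else 0)"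
      using enc[of U "S \<union> T"] fin by auto
  qed simp
  also have "\<dots> = sq_coeff x S * sq_coeff y T" using fin by simp
  finally have "sq_coeff (x * y) (S \<union> T) \<noteq> 0" using x y by (auto simp: lead_def)
  moreover have "set_encode R \<le> set_encode (S \<union> T)" if "sq_coeff (x * y) R \<noteq> 0" for R
    using that by (rule sq_coeff_times_nonzeroE) (use enc in auto)
  ultimately show ?thesis by (simp add: lead_def)
qed

lemma lead_cancel:
  fixes x y :: "'k::field sqfree"
  assumes x: "lead x S" and y: "lead y S"
    and z: "lead (x - const (sq_coeff x S / sq_coeff y S) * y) T"
  shows "set_encode T < set_encode S"
proof -
  let ?z = "x - const (sq_coeff x S / sq_coeff y S) * y"
  have "sq_coeff ?z S = 0" using y by (simp add: lead_def)
  then have "T \<noteq> S" using z by (auto simp: lead_def)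
  moreover have "sq_coeff x T \<noteq> 0 \<or> sq_coeff y T \<noteq> 0" using z by (auto simp: lead_def)
  then have "set_encode T \<le> set_encode S" using x y by (auto simp: lead_def)
  ultimately show ?thesis
    using set_encode_eq[of T S] lead_finite[OF z] lead_finite[OF x] by auto
qed

text \<open>
  The sets are the leading monomials of elements \<open>g i\<close> congruent to \<open>w i\<close> modulo the
  ideal generated by the earlier \<open>w j\<close> and chosen with smallest leading monomial. All
  of \<open>g i + ideal\<close> is nonzero because \<open>u i\<close> kills the ideal but not \<open>w i\<close>; and a monomial
  multiple of \<open>g i\<close> with leading monomial \<open>lead (g j)\<close>, \<open>i < j\<close>, would allow to reduce
  \<open>g j\<close> further.
\<close>

lemma leading_monomials_intersecting_antichain:
  fixes w u :: "nat \<Rightarrow> 'k::field sqfree"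
  assumes hom: "\<And>i. i \<in> {1..m} \<Longrightarrow> homogeneous n (k i) (w i)"
    and mono: "\<And>i j. i \<in> {1..m} \<Longrightarrow> j \<in> {1..m} \<Longrightarrow> i \<le> j \<Longrightarrow> k i \<le> k j"
    and ww: "\<And>i j. i \<in> {1..m} \<Longrightarrow> j \<in> {1..m} \<Longrightarrow> w i * w j = 0"
    and wu: "\<And>i j. i \<in> {1..m} \<Longrightarrow> j \<in> {1..m} \<Longrightarrow> i < j \<Longrightarrow> w i * u j = 0"
    and wu': "\<And>i. i \<in> {1..m} \<Longrightarrow> w i * u i \<noteq> 0"
  obtains S :: "nat \<Rightarrow> nat set"
  where "\<And>i. i \<in> {1..m} \<Longrightarrow> S i \<subseteq> {..<n} \<and> card (S i) = k i"
    and "\<And>i j. i \<in> {1..m} \<Longrightarrow> j \<in> {1..m} \<Longrightarrow> S i \<inter> S j \<noteq> {}"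
    and "\<And>i j. i \<in> {1..m} \<Longrightarrow> j \<in> {1..m} \<Longrightarrow> S i \<subseteq> S j \<Longrightarrow> i = j"
proof -
  \<comment> \<open>The part in degree \<open>k i\<close> of the ideal generated by the earlier
    \<open>w j\<close>. Staying in one degree keeps \<open>g i\<close> homogeneous, which gives its
    leading monomial the size \<open>k i\<close>.\<close>
  define J where "J i = {y. homogeneous n (k i) y \<and> (\<exists>c. y = (\<Sum>j\<in>{1..<i}. w j * c j))}" for i
  have J0: "0 \<in> J i" for i
    unfolding J_def by (auto intro!: exI[of _ "\<lambda>_. 0"])
  have J_add: "x + const c * y \<in> J i" if "x \<in> J i" "y \<in> J i" for x y c i
  proof -
    obtain p q where "x = (\<Sum>j\<in>{1..<i}. w j * p j)" "y = (\<Sum>j\<in>{1..<i}. w j * q j)"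
      using \<open>x \<in> J i\<close> \<open>y \<in> J i\<close> by (auto simp: J_def)
    then have "x + const c * y = (\<Sum>j\<in>{1..<i}. w j * (p j + const c * q j))"
      by (simp add: sum.distrib sum_distrib_left algebra_simps)
    moreover have "homogeneous n (k i) (x + const c * y)"
      using \<open>x \<in> J i\<close> \<open>y \<in> J i\<close> by (auto simp: J_def intro: homogeneous_add homogeneous_const_mult)
    ultimately show ?thesis
      unfolding J_def by (intro CollectI conjI exI[of _ "\<lambda>j. p j + const c * q j"])
  qed
  have Ju: "y * u i = 0" if y: "y \<in> J i" and i: "i \<in> {1..m}" for y i
  proof -
    obtain c where "y = (\<Sum>j\<in>{1..<i}. w j * c j)" using y by (auto simp: J_def)
    then have "y * u i = (\<Sum>j\<in>{1..<i}. (w j * u i) * c j)" by (simp add: sum_distrib_left sum_distrib_right mult_ac)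
    also have "\<dots> = 0" using i wu by (intro sum.neutral) auto
    finally show ?thesis .
  qed
  have ex: "\<exists>g S. g - w i \<in> J i \<and> lead g S \<and> (\<forall>y\<in>J i. \<not> lead y S)" if i: "i \<in> {1..m}" for i
  proof -
    let ?P = "\<lambda>(g, S). g - w i \<in> J i \<and> lead g S"
    have ex_lead: "\<exists>S. lead g S" if g: "g - w i \<in> J i" for g
    proof -
      have "g * u i = w i * u i" using Ju[OF g i] by (simp add: algebra_simps)
      then have "g \<noteq> 0" using wu'[OF i] by auto
      moreover have "homogeneous n (k i) g"
        using homogeneous_add[OF _ hom[OF i], of "g - w i"] g by (simp add: J_def)
      ultimately show ?thesis by (rule lead_exists[rotated])
    qed
    obtain S0 where "?P (w i, S0)" using ex_lead[of "w i"] J0 by auto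
    then obtain g S where gS: "?P (g, S)"
      and min: "\<And>h T. ?P (h, T) \<Longrightarrow> set_encode S \<le> set_encode T"
      using ex_has_least_nat[of ?P "(w i, S0)" "\<lambda>(g, S). set_encode S"] by auto
    have "\<not> lead y S" if y: "y \<in> J i" for y
    proof
      assume lead: "lead y S"
      let ?h = "g - const (sq_coeff g S / sq_coeff y S) * y"
      have eq: "?h - w i = (g - w i) + const (- (sq_coeff g S / sq_coeff y S)) * y"
        by (rule sqfree_eqI) simp
      have h: "?h - w i \<in> J i"
        unfolding eq by (intro J_add) (use gS y in simp_all)
      obtain T where T: "lead ?h T" using ex_lead[OF h] by blast
      have "set_encode T < set_encode S" by (rule lead_cancel[OF _ lead T]) (use gS in simp)
      moreover have "set_encode S \<le> set_encode T" using min h T by simp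
      ultimately show False by simp
    qed
    then show ?thesis using gS by blast
  qed
  then obtain g S where g: "\<And>i. i \<in> {1..m} \<Longrightarrow> g i - w i \<in> J i"
    and S: "\<And>i. i \<in> {1..m} \<Longrightarrow> lead (g i) (S i)"
    and irred: "\<And>i y. i \<in> {1..m} \<Longrightarrow> y \<in> J i \<Longrightarrow> \<not> lead y (S i)"
    by metis
  \<comment> \<open>\<open>g i\<close> lies in the ideal generated by the \<open>w j\<close> with
    \<open>j \<le> i\<close>. Hence products of the \<open>g i\<close> vanish, and multiples of
    \<open>g i\<close> are in the ideal used for any later index.\<close>
  have g_sum: "\<exists>c. g i = (\<Sum>j\<in>{1..i}. w j * c j)" if i: "i \<in> {1..m}" for i
  proof -
    obtain c where "g i - w i = (\<Sum>j\<in>{1..<i}. w j * c j)"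
      using g[OF i] by (auto simp: J_def)
    then have c: "g i = (\<Sum>j\<in>{1..<i}. w j * c j) + w i" by (simp add: algebra_simps)
    have "{1..i} = insert i {1..<i}" using i by auto
    then have "g i = (\<Sum>j\<in>{1..i}. w j * (c(i := 1)) j)"
      unfolding c by (auto intro!: sum.cong)
    then show ?thesis by blast
  qed
  have g_hom: "homogeneous n (k i) (g i)" if i: "i \<in> {1..m}" for i
    using homogeneous_add[OF _ hom[OF i], of "g i - w i"] g[OF i] by (simp add: J_def)
  have S_card: "S i \<subseteq> {..<n} \<and> card (S i) = k i" if i: "i \<in> {1..m}" for i
    using g_hom[OF i] S[OF i] by (auto simp: homogeneous_def lead_def)
  have gg: "g i * g j = 0" if ij: "i \<in> {1..m}" "j \<in> {1..m}" for i j
  proof -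
    obtain c d where c: "g i = (\<Sum>p\<in>{1..i}. w p * c p)" and d: "g j = (\<Sum>q\<in>{1..j}. w q * d q)"
      using g_sum[OF ij(1)] g_sum[OF ij(2)] by blast
    have "w p * c p * (w q * d q) = 0" if "p \<in> {1..i}" "q \<in> {1..j}" for p q
    proof -
      have eq: "w p * c p * (w q * d q) = (w p * w q) * (c p * d q)" by (simp only: mult_ac)
      have "w p * w q = 0" using that ij by (intro ww) auto
      then show ?thesis unfolding eq by (simp only: mult_zero_left)
    qed
    then show ?thesis unfolding c d sum_product by (auto intro!: sum.neutral)
  qed
  have not_sub: "\<not> S i \<subseteq> S j" if ij: "i \<in> {1..m}" "j \<in> {1..m}" "i < j" for i j
  proof
    assume sub: "S i \<subseteq> S j"
    let ?U = "S j - S i"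
    let ?y = "g i * sq_term 1 ?U"
    have U: "?U \<subseteq> {..<n}" "finite ?U" using S_card[OF ij(2)] by (auto intro: finite_subset)
    have "lead (sq_term (1::'k) ?U) ?U" using U by (auto simp: lead_def sq_coeff_sq_term)
    from lead_times[OF S[OF ij(1)] this] have "lead ?y (S j)"
      using sub by (simp add: Un_absorb1)
    moreover have "?y \<in> J j"
    proof -
      have finS: "finite (S i)" "finite (S j)"
        using lead_finite[OF S[OF ij(1)]] lead_finite[OF S[OF ij(2)]] .
      have "k i + card ?U = k j"
        using S_card[OF ij(1)] S_card[OF ij(2)] card_Diff_subset[OF finS(1) sub] card_mono[OF finS(2) sub]
        by linarith
      then have "homogeneous n (k j) ?y"
        using homogeneous_mult[OF g_hom[OF ij(1)] homogeneous_sq_term[OF U(1), of 1]] by simp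
      moreover obtain c where c: "g i = (\<Sum>p\<in>{1..i}. w p * c p)" using g_sum[OF ij(1)] by blast
      have "?y = (\<Sum>p\<in>{1..i}. w p * (c p * sq_term 1 ?U))"
        unfolding c by (simp add: sum_distrib_right mult.assoc)
      \<comment> \<open>Coefficients are padded by 0 for the indices strictly between
        \<open>i\<close> and \<open>j\<close>.\<close>
      then have "?y = (\<Sum>p\<in>{1..<j}. w p * (if p \<le> i then c p * sq_term 1 ?U else 0))"
        using ij by (simp only:) (intro sum.mono_neutral_cong_left, auto)
      ultimately show ?thesis unfolding J_def by (intro CollectI conjI exI)
    qed
    ultimately show False using irred[OF ij(2)] by blast
  qed
  show thesis
  proof (rule that[of S])
    show "S i \<subseteq> {..<n} \<and> card (S i) = k i" if "i \<in> {1..m}" for i using S_card that .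
    \<comment> \<open>Disjoint leading monomials would give \<open>g i * g j = 0\<close> a leading
      monomial.\<close>
    show "S i \<inter> S j \<noteq> {}" if ij: "i \<in> {1..m}" "j \<in> {1..m}" for i j
      using lead_times[OF S[OF ij(1)] S[OF ij(2)]] unfolding gg[OF ij] by (auto simp: lead_def)
    show "i = j" if ij: "i \<in> {1..m}" "j \<in> {1..m}" and sub: "S i \<subseteq> S j" for i j
    proof (cases i j rule: linorder_cases)
      case less
      then show ?thesis using not_sub[OF ij] sub by blast
    next
      \<comment> \<open>Here the later set lies in the earlier one; sizes are nondecreasing in the
        index, so the two sets are equal and \<open>not_sub\<close> applies in the other
        direction.\<close>
      case greater
      have "card (S j) \<le> card (S i)" using mono[OF ij(2,1)] greater S_card[OF ij(1)] S_card[OF ij(2)] by simp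
      then have "S i = S j" using card_seteq[OF lead_finite[OF S[OF ij(2)]] sub] by blast
      then show ?thesis using not_sub[OF ij(2,1) greater] by blast
    qed
  qed
qed

subsection \<open>Contracted products of vectors\<close>

text \<open>
  Characteristic 2 makes the squarefree algebra an exterior algebra: vectors square to zero and
  no signs are needed.
\<close>

lemma sqfree_char_2:
  fixes x :: "'k::comm_ring_1 sqfree"
  assumes "(1::'k) + 1 = 0"
  shows "x + x = 0"
proof (rule sqfree_eqI)
  fix S
  have "sq_coeff (x + x) S = (1 + 1) * sq_coeff x S" by (simp only: sq_coeff_simps distrib_right mult_1)
  then show "sq_coeff (x + x) S = sq_coeff 0 S"
    by (simp only: assms mult_zero_left zero_sqfree.rep_eq)
qed

text \<open>Every cross term occurs twice and cancels.\<close>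

lemma square_sum_eq_0:
  fixes f :: "'i \<Rightarrow> 'k::comm_ring_1 sqfree"
  assumes "(1::'k) + 1 = 0" "\<And>i. i \<in> I \<Longrightarrow> f i * f i = 0"
  shows "sum f I * sum f I = 0"
  using assms(2)
proof (induction I rule: infinite_finite_induct)
  case (insert i I)
  have "(f i + sum f I) * (f i + sum f I) =
      f i * f i + (f i * sum f I + f i * sum f I) + sum f I * sum f I"
    by (simp add: algebra_simps)
  then show ?case using insert sqfree_char_2[OF assms(1)] by simp
qed auto

section \<open>Linear forms and their contraction\<close>

definition vec :: "nat \<Rightarrow> (nat \<Rightarrow> 'k::comm_ring_1) \<Rightarrow> 'k sqfree" where
  "vec n v = (\<Sum>j<n. sq_term (v j) {j})"

lemma vec_square:
  fixes v :: "nat \<Rightarrow> 'k::comm_ring_1"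
  assumes "(1::'k) + 1 = 0"
  shows "vec n v * vec n v = 0"
  unfolding vec_def by (rule square_sum_eq_0[OF assms]) (simp add: sq_term_times_sq_term)

lemma homogeneous_vec: "homogeneous n 1 (vec n v)"
  unfolding vec_def
proof (rule homogeneous_sum)
  fix j assume "j \<in> {..<n}"
  then show "homogeneous n 1 (sq_term (v j) {j})" using homogeneous_sq_term[of "{j}" n "v j"] by simp
qed

lemma sq_coeff_vec_singleton: "sq_coeff (vec n v) {j} = (if j < n then v j else 0)"
proof -
  have "sq_coeff (vec n v) {j} = (\<Sum>i<n. if i = j then v j else 0)"
    unfolding vec_def sq_coeff_sum by (intro sum.cong) (auto simp: sq_coeff_sq_term)
  then show ?thesis by simp
qed

text \<open>Interior product with the monomial \<open>T\<close>: keep the terms divisible by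
  \<open>T\<close> and divide them by it.\<close>

lift_definition contract :: "nat set \<Rightarrow> 'k::comm_ring_1 sqfree \<Rightarrow> 'k sqfree" is
  "\<lambda>T f S. if S \<inter> T = {} then f (S \<union> T) else 0" by auto

text \<open>A factor free of the variables in \<open>T\<close> takes no part in the division by
  \<open>T\<close>, so it can be pulled out.\<close>

lemma contract_times:
  assumes "finite T" and x: "\<And>U. sq_coeff x U \<noteq> 0 \<Longrightarrow> U \<inter> T = {}"
  shows "contract T (x * z) = x * contract T z"
proof (rule sqfree_eqI)
  fix S :: "nat set" assume S: "finite S"
  show "sq_coeff (contract T (x * z)) S = sq_coeff (x * contract T z) S"
  proof (cases "S \<inter> T = {}")
    case True
    have "(\<Sum>U\<in>Pow (S \<union> T). sq_coeff x U * sq_coeff z (S \<union> T - U)) =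
        (\<Sum>U\<in>Pow S. sq_coeff x U * sq_coeff (contract T z) (S - U))"
    proof (rule sum.mono_neutral_cong_right)
      show "\<forall>U\<in>Pow (S \<union> T) - Pow S. sq_coeff x U * sq_coeff z (S \<union> T - U) = 0"
        using x by (auto simp: disjoint_iff) (metis UnE mult_zero_left subsetD)
      fix U assume "U \<in> Pow S"
      then have "S \<union> T - U = S - U \<union> T" "(S - U) \<inter> T = {}" using True by auto
      then show "sq_coeff x U * sq_coeff z (S \<union> T - U) = sq_coeff x U * sq_coeff (contract T z) (S - U)"
        by (simp add: contract.rep_eq)
    qed (use S assms in auto)
    then show ?thesis using True by (simp add: contract.rep_eq sq_coeff_times)
  next
    case False
    have "sq_coeff x U * sq_coeff (contract T z) (S - U) = 0" if "U \<in> Pow S" for U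
    proof (cases "sq_coeff x U = 0")
      case False
      then have "(S - U) \<inter> T \<noteq> {}" using x[of U] \<open>S \<inter> T \<noteq> {}\<close> by auto
      then show ?thesis by (simp add: contract.rep_eq)
    qed simp
    then show ?thesis using False by (simp add: contract.rep_eq sq_coeff_times)
  qed
qed

lemma contract_sq_term:
  assumes "finite S" "finite T" "S \<inter> T = {}"
  shows "contract T (sq_term c (S \<union> T)) = sq_term c S"
  using assms by (intro sqfree_eqI) (auto simp: contract.rep_eq sq_coeff_sq_term)

lemma homogeneous_contract:
  assumes "homogeneous (n + t) k x"
  shows "homogeneous n (k - t) (contract {n..<n + t} x)"
  unfolding homogeneous_def
proof (intro allI impI)
  fix S assume "sq_coeff (contract {n..<n + t} x) S \<noteq> 0"
  then have disj: "S \<inter> {n..<n + t} = {}" and "sq_coeff x (S \<union> {n..<n + t}) \<noteq> 0"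
    by (auto simp: contract.rep_eq split: if_splits)
  then have sub: "S \<union> {n..<n + t} \<subseteq> {..<n + t}" and card: "card (S \<union> {n..<n + t}) = k"
    using assms unfolding homogeneous_def by blast+
  have "finite S" using sub by (auto intro: finite_subset)
  then have "k = card S + t" using card disj by (simp add: card_Un_disjoint)
  moreover have "S \<subseteq> {..<n}" using sub disj by force
  ultimately show "S \<subseteq> {..<n} \<and> card S = k - t" by simp
qed

text \<open>Gaussian elimination, one coordinate at a time.\<close>

lemma exists_linear_dependence:
  fixes M :: "'i \<Rightarrow> 'j \<Rightarrow> 'k::field"
  assumes "finite J" "finite I" "card J < card I"
  shows "\<exists>c. (\<exists>i\<in>I. c i \<noteq> 0) \<and> (\<forall>j\<in>J. (\<Sum>i\<in>I. c i * M i j) = 0)"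
  using assms
proof (induction J arbitrary: I M rule: finite_induct)
  case empty
  then have "I \<noteq> {}" by auto
  then show ?case by (intro exI[of _ "\<lambda>_. 1"]) auto
next
  case (insert j J)
  show ?case
  proof (cases "\<forall>i\<in>I. M i j = 0")
    case True
    have "card J < card I" using insert by simp
    from insert.IH[OF insert.prems(1) this] obtain c where
      "\<exists>i\<in>I. c i \<noteq> 0" "\<forall>j\<in>J. (\<Sum>i\<in>I. c i * M i j) = 0" by blast
    then show ?thesis using True by (intro exI[of _ c]) auto
  next
    case False
    then obtain i0 where i0: "i0 \<in> I" "M i0 j \<noteq> 0" by auto
    let ?I = "I - {i0}"
    \<comment> \<open>Subtracting multiples of the pivot row \<open>i0\<close> clears column
      \<open>j\<close>. The value of \<open>d\<close> at \<open>i0\<close> then collects these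
      multiples, so that \<open>d\<close> on the original rows acts as \<open>c\<close> on the
      reduced ones.\<close>
    let ?M = "\<lambda>i l. M i l - M i j / M i0 j * M i0 l"
    have "card J < card ?I" using insert i0 by simp
    from insert.IH[OF _ this, of ?M] insert.prems(1) obtain c where
      c: "\<exists>i\<in>?I. c i \<noteq> 0" "\<forall>l\<in>J. (\<Sum>i\<in>?I. c i * ?M i l) = 0" by auto
    define d where "d = c(i0 := - (\<Sum>i\<in>?I. c i * (M i j / M i0 j)))"
    have d: "(\<Sum>i\<in>I. d i * M i l) = (\<Sum>i\<in>?I. c i * ?M i l)" for l
    proof -
      have "(\<Sum>i\<in>I. d i * M i l) = d i0 * M i0 l + (\<Sum>i\<in>?I. d i * M i l)"
        using insert.prems(1) i0(1) by (rule sum.remove)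
      also have "(\<Sum>i\<in>?I. d i * M i l) = (\<Sum>i\<in>?I. c i * M i l)"
        by (intro sum.cong) (auto simp: d_def)
      finally show ?thesis
        by (simp add: d_def sum_distrib_left sum_distrib_right sum_subtractf algebra_simps)
    qed
    have "\<exists>i\<in>I. d i \<noteq> 0" using c(1) by (auto simp: d_def)
    moreover have "(\<Sum>i\<in>I. d i * M i l) = 0" if "l \<in> insert j J" for l
      using that c(2) i0(2) by (auto simp: d)
    ultimately show ?thesis by blast
  qed
qed

text \<open>The factor of index \<open>i0\<close> may be replaced by a combination in which it has a
  nonzero coefficient: each other term repeats a factor already in the product and so
  vanishes.\<close>

lemma prod_vec_factor:
  fixes V :: "'a \<Rightarrow> nat \<Rightarrow> 'k::field"
  assumes char: "(1::'k) + 1 = 0" and "finite A" "I \<subseteq> A" "i0 \<in> I" "c i0 \<noteq> 0"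
  shows "(\<Prod>s\<in>A. vec n (V s)) =
    (\<Sum>i\<in>I. const (c i) * vec n (V i)) * (const (1 / c i0) * (\<Prod>s\<in>A - {i0}. vec n (V s)))"
proof -
  let ?v = "\<lambda>s. vec n (V s)"
  let ?P = "\<Prod>s\<in>A - {i0}. ?v s"
  have finI: "finite I" using assms finite_subset by auto
  have "const (c i) * ?v i * ?P = (if i = i0 then const (c i0) * prod ?v A else 0)" if "i \<in> I" for i
  proof (cases "i = i0")
    case True
    then show ?thesis using that assms prod.remove[of A i0 ?v] by (auto simp: mult.assoc)
  next
    case False
    then have "?P = ?v i * prod ?v (A - {i0} - {i})"
      using that assms by (intro prod.remove) auto
    then have "?v i * ?P = (?v i * ?v i) * prod ?v (A - {i0} - {i})" by (simp add: mult.assoc)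
    then show ?thesis using False vec_square[OF char] by (simp add: mult.assoc)
  qed
  then have eq: "(\<Sum>i\<in>I. const (c i) * ?v i) * ?P = const (c i0) * prod ?v A"
    using finI assms by (simp add: sum_distrib_right)
  have "(\<Sum>i\<in>I. const (c i) * ?v i) * (const (1 / c i0) * ?P) =
      const (1 / c i0) * (const (c i0) * prod ?v A)"
    unfolding eq[symmetric] by (rule mult.left_commute)
  also have "\<dots> = const (1 / c i0) * const (c i0) * prod ?v A"
    by (rule mult.assoc[symmetric])
  also have "const (1 / c i0) * const (c i0) = 1"
    using assms by (simp add: sq_term_times_sq_term)
  finally show ?thesis by simp
qed

text \<open>
  Some nontrivial combination of the \<open>V s\<close>, \<open>s \<in> A \<inter> B\<close>, has its last \<open>t\<close> coordinates equal
  to zero; it divides both products and survives the contraction as a common factor.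
\<close>

lemma contract_prod_vec_times_eq_0:
  fixes V :: "'a \<Rightarrow> nat \<Rightarrow> 'k::field"
  assumes char: "(1::'k) + 1 = 0" and fin: "finite A" "finite B" and card: "t < card (A \<inter> B)"
  shows "contract {n..<n + t} (\<Prod>s\<in>A. vec (n + t) (V s)) *
    contract {n..<n + t} (\<Prod>s\<in>B. vec (n + t) (V s)) = 0"
proof -
  let ?T = "{n..<n + t}" and ?I = "A \<inter> B"
  obtain c where c: "\<exists>i\<in>?I. c i \<noteq> 0" "\<forall>j\<in>?T. (\<Sum>i\<in>?I. c i * V i j) = 0"
    using exists_linear_dependence[of ?T ?I V] fin card by auto
  then obtain i0 where i0: "i0 \<in> ?I" "c i0 \<noteq> 0" by blast
  define x where "x = (\<Sum>i\<in>?I. const (c i) * vec (n + t) (V i))"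
  have hom: "homogeneous (n + t) 1 x"
    unfolding x_def by (intro homogeneous_sum homogeneous_const_mult homogeneous_vec)
  \<comment> \<open>\<open>x\<close> has degree 1, so its monomials are single variables, and
    \<open>c\<close> was chosen to make the coefficients of the last \<open>t\<close> variables
    vanish.\<close>
  have x: "U \<inter> ?T = {}" if "sq_coeff x U \<noteq> 0" for U
  proof (rule ccontr)
    assume "U \<inter> ?T \<noteq> {}"
    moreover have "card U = 1" using hom that by (auto simp: homogeneous_def)
    ultimately obtain j where j: "U = {j}" "j \<in> ?T" by (auto simp: card_1_singleton_iff)
    then have "sq_coeff x U = (\<Sum>i\<in>?I. c i * V i j)"
      by (simp add: x_def sq_coeff_vec_singleton)
    then show False using c(2) j that by auto
  qed
  have square: "x * x = 0"
    unfolding x_def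
  proof (rule square_sum_eq_0[OF char])
    fix i
    have "const (c i) * vec (n + t) (V i) * (const (c i) * vec (n + t) (V i)) =
        const (c i) * const (c i) * (vec (n + t) (V i) * vec (n + t) (V i))"
      by (simp only: mult_ac)
    then show "const (c i) * vec (n + t) (V i) * (const (c i) * vec (n + t) (V i)) = 0"
      by (simp only: vec_square[OF char] mult_zero_right)
  qed
  have factor: "\<exists>y. contract ?T (\<Prod>s\<in>C. vec (n + t) (V s)) = x * y" if "finite C" "?I \<subseteq> C" for C
  proof -
    have "(\<Prod>s\<in>C. vec (n + t) (V s)) =
        x * (const (1 / c i0) * (\<Prod>s\<in>C - {i0}. vec (n + t) (V s)))"
      unfolding x_def using that i0 by (intro prod_vec_factor[OF char]) auto
    then show ?thesis using contract_times[where T = ?T, OF _ x] by auto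
  qed
  obtain y where y: "contract ?T (\<Prod>s\<in>A. vec (n + t) (V s)) = x * y"
    using factor[OF fin(1)] by auto
  obtain z where z: "contract ?T (\<Prod>s\<in>B. vec (n + t) (V s)) = x * z"
    using factor[OF fin(2)] by auto
  have "x * y * (x * z) = x * x * (y * z)" by (simp only: mult_ac)
  then show ?thesis by (simp add: y z square)
qed

section \<open>General position through polynomials in one parameter\<close>

definition polynomial_fun :: "('k::comm_ring_1 \<Rightarrow> 'k) \<Rightarrow> bool" where
  "polynomial_fun f \<longleftrightarrow> (\<exists>p. f = poly p)"

lemma polynomial_fun_mult: "polynomial_fun f \<Longrightarrow> polynomial_fun g \<Longrightarrow> polynomial_fun (\<lambda>l. f l * g l)"
proof -
  assume "polynomial_fun f" "polynomial_fun g"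
  then obtain p q where "f = poly p" "g = poly q" unfolding polynomial_fun_def by blast
  then have "(\<lambda>l. f l * g l) = poly (p * q)" by auto
  then show ?thesis unfolding polynomial_fun_def by blast
qed

lemma polynomial_fun_sum:
  assumes "\<And>i. i \<in> A \<Longrightarrow> polynomial_fun (f i)"
  shows "polynomial_fun (\<lambda>l. \<Sum>i\<in>A. f i l)"
proof -
  obtain p where "\<And>i. i \<in> A \<Longrightarrow> f i = poly (p i)"
    using assms unfolding polynomial_fun_def by metis
  then have "(\<lambda>l. \<Sum>i\<in>A. f i l) = poly (\<Sum>i\<in>A. p i)" by (auto simp: poly_sum)
  then show ?thesis unfolding polynomial_fun_def by blast
qed

lemma polynomial_fun_const: "polynomial_fun (\<lambda>_. c)"
  unfolding polynomial_fun_def by (rule exI[of _ "[:c:]"]) auto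

lemma polynomial_fun_line: "polynomial_fun (\<lambda>l. a + l * b)"
  unfolding polynomial_fun_def by (rule exI[of _ "[:a, b:]"]) auto

lemma polynomial_fun_sq_coeff_times:
  assumes "\<And>S. polynomial_fun (\<lambda>l. sq_coeff (x l) S)" "\<And>S. polynomial_fun (\<lambda>l. sq_coeff (y l) S)"
  shows "polynomial_fun (\<lambda>l. sq_coeff (x l * y l) S)"
  unfolding sq_coeff_times by (intro polynomial_fun_sum polynomial_fun_mult assms)

lemma polynomial_fun_sq_coeff_prod:
  assumes "\<And>i S. polynomial_fun (\<lambda>l. sq_coeff (x i l) S)"
  shows "polynomial_fun (\<lambda>l. sq_coeff (\<Prod>i\<in>A. x i l) S)"
proof (induction A arbitrary: S rule: infinite_finite_induct)
  case (insert i A)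
  show ?case
    unfolding prod.insert[OF insert.hyps] by (rule polynomial_fun_sq_coeff_times[OF assms insert.IH])
qed (simp_all add: polynomial_fun_const)

lemma polynomial_fun_sq_coeff_vec:
  assumes "\<And>j. polynomial_fun (\<lambda>l. v l j)"
  shows "polynomial_fun (\<lambda>l. sq_coeff (vec n (v l)) S)"
proof -
  have "polynomial_fun (\<lambda>l. sq_coeff (sq_term (v l j) {j}) S)" for j
    by (cases "S = {j}") (simp_all add: sq_coeff_sq_term assms polynomial_fun_const)
  then show ?thesis unfolding vec_def sq_coeff_sum by (rule polynomial_fun_sum)
qed

lemma polynomial_fun_sq_coeff_contract:
  assumes "\<And>S. polynomial_fun (\<lambda>l. sq_coeff (x l) S)"
  shows "polynomial_fun (\<lambda>l. sq_coeff (contract T (x l)) S)"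
  by (cases "S \<inter> T = {}") (simp_all add: contract.rep_eq assms polynomial_fun_const)

text \<open>
  Joining two points by a line reduces the claim to polynomials in one variable.
\<close>

lemma exists_common_nonzero:
  fixes F :: "'i \<Rightarrow> ('a \<Rightarrow> nat \<Rightarrow> 'k::field) \<Rightarrow> 'k"
  assumes inf: "infinite (UNIV :: 'k set)" and "finite I"
    and line: "\<And>i V W. i \<in> I \<Longrightarrow> polynomial_fun (\<lambda>l. F i (\<lambda>s j. V s j + l * (W s j - V s j)))"
    and nonzero: "\<And>i. i \<in> I \<Longrightarrow> \<exists>V. F i V \<noteq> 0"
  shows "\<exists>V. \<forall>i\<in>I. F i V \<noteq> 0"
  using assms(2-)
proof (induction I rule: finite_induct)
  case (insert i0 I)
  obtain V where V: "\<forall>i\<in>I. F i V \<noteq> 0" using insert by auto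
  obtain W where W: "F i0 W \<noteq> 0" using insert.prems(2)[of i0] by auto
  define path where "path l = (\<lambda>s j. V s j + l * (W s j - V s j))" for l
  have "polynomial_fun (\<lambda>l. F i (path l))" if "i \<in> insert i0 I" for i
    unfolding path_def using insert.prems(1)[OF that] .
  then obtain p where p: "\<And>i. i \<in> insert i0 I \<Longrightarrow> (\<lambda>l. F i (path l)) = poly (p i)"
    unfolding polynomial_fun_def by metis
  \<comment> \<open>The old conditions hold at the end \<open>V\<close> of the line and the new one
    at the end \<open>W\<close>, so no polynomial is zero and all roots together form a finite
    set.\<close>
  have "p i \<noteq> 0" if i: "i \<in> insert i0 I" for i
  proof (cases "i \<in> I")
    case True
    moreover have "path 0 = V" by (simp add: path_def)
    ultimately have "poly (p i) 0 \<noteq> 0" using p[OF i] V by (metis)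
    then show ?thesis by auto
  next
    case False
    moreover have "path 1 = W" by (simp add: path_def)
    ultimately have "poly (p i) 1 \<noteq> 0" using p[OF i] W i by (metis insertE)
    then show ?thesis by auto
  qed
  then have "finite (\<Union>i\<in>insert i0 I. {l. poly (p i) l = 0})"
    using insert.hyps by (intro finite_UN_I) (auto intro: poly_roots_finite)
  then obtain l where "l \<notin> (\<Union>i\<in>insert i0 I. {l. poly (p i) l = 0})"
    using inf by (metis ex_new_if_finite)
  then have "\<forall>i\<in>insert i0 I. F i (path l) \<noteq> 0" using p by (auto simp: fun_eq_iff)
  then show ?case by blast
qed simp

lemma prod_vec_unit:
  assumes "finite A" "inj_on f A" "f ` A \<subseteq> {..<n}"
  shows "(\<Prod>s\<in>A. vec n (\<lambda>j. if j = f s then 1 else 0)) = (sq_term 1 (f ` A) :: 'k::comm_ring_1 sqfree)"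
  using assms
proof (induction A rule: finite_induct)
  case (insert a A)
  have "vec n (\<lambda>j. if j = f a then 1 else 0) = (sq_term 1 {f a} :: 'k sqfree)"
  proof (rule sqfree_eqI)
    fix S :: "nat set"
    have "sq_coeff (vec n (\<lambda>j. if j = f a then 1 else 0)) S =
      (\<Sum>j<n. if j = f a then (if S = {f a} then 1 else 0) else (0::'k))"
      unfolding vec_def sq_coeff_sum by (intro sum.cong) (auto simp: sq_coeff_sq_term)
    also have "\<dots> = sq_coeff (sq_term 1 {f a}) S"
      using insert.prems by (simp add: sq_coeff_sq_term)
    finally show "sq_coeff (vec n (\<lambda>j. if j = f a then 1 else 0)) S = \<dots>" .
  qed
  then show ?case using insert by (simp add: sq_term_times_sq_term)
qed simp

text \<open>Unit vectors suffice. \<open>A \<inter> B\<close> is placed on a subset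
  \<open>T1\<close> of the last \<open>t\<close> coordinates; \<open>A - B\<close> and
  \<open>B - A\<close> each fill up the rest of these, and what remains of them covers complementary
  parts of the first \<open>n\<close>. The contractions are then complementary monomials.\<close>

lemma exists_contract_prod_vec_nonzero:
  fixes A B :: "'a set"
  assumes fin: "finite A" "finite B" and "t \<le> card A" "t \<le> card B"
    and sum: "card A + card B = n + 2 * t" and small: "card (A \<inter> B) \<le> t"
  shows "\<exists>V. sq_coeff (contract {n..<n + t} (\<Prod>s\<in>A. vec (n + t) (V s)) *
    contract {n..<n + t} (\<Prod>s\<in>B. vec (n + t) (V s))) {..<n} \<noteq> (0 :: 'k::comm_ring_1)"
proof -
  let ?T = "{n..<n + t}" and ?S = "{..<card A - t}" and ?S' = "{card A - t..<n}"
  obtain T1 where T1: "T1 \<subseteq> ?T" "card T1 = card (A \<inter> B)"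
    using obtain_subset_with_card_n[of "card (A \<inter> B)" ?T] small by auto
  have finT1: "finite T1" using T1(1) finite_subset by blast
  have le: "card A - t \<le> n" using assms by simp
  have cT: "card (?T - T1) = t - card (A \<inter> B)" using T1 finT1 by (simp add: card_Diff_subset)
  have "card (A - B) = card A - card (A \<inter> B)" "card (B - A) = card B - card (A \<inter> B)"
    using fin card_Diff_subset_Int[of A B] card_Diff_subset_Int[of B A] by (simp_all add: Int_commute)
  moreover have "card ((?T - T1) \<union> ?S) = card (?T - T1) + card ?S"
    using le by (intro card_Un_disjoint) auto
  moreover have "card ((?T - T1) \<union> ?S') = card (?T - T1) + card ?S'"
    using le by (intro card_Un_disjoint) auto
  \<comment> \<open>The sizes fit: after \<open>t\<close> elements of each set are spent on the last
    \<open>t\<close> coordinates, \<open>card A - t\<close> and \<open>card B - t\<close> remain,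
    and these add up to \<open>n\<close>.\<close>
  ultimately have cards: "card (A - B) = card ((?T - T1) \<union> ?S)" "card (B - A) = card ((?T - T1) \<union> ?S')"
    using assms cT by auto
  obtain f where f: "bij_betw f (A \<inter> B) T1"
    using finite_same_card_bij[of "A \<inter> B" T1] fin finT1 T1 by auto
  obtain g where g: "bij_betw g (A - B) ((?T - T1) \<union> ?S)"
    using finite_same_card_bij[OF _ _ cards(1)] fin by auto
  obtain h where h: "bij_betw h (B - A) ((?T - T1) \<union> ?S')"
    using finite_same_card_bij[OF _ _ cards(2)] fin by auto
  define \<phi> where "\<phi> s = (if s \<in> A then if s \<in> B then f s else g s else h s)" for s
  have \<phi>f: "bij_betw \<phi> (A \<inter> B) T1" using f by (subst bij_betw_cong[of _ \<phi> f]) (auto simp: \<phi>_def)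
  have \<phi>g: "bij_betw \<phi> (A - B) ((?T - T1) \<union> ?S)"
    using g by (subst bij_betw_cong[of _ \<phi> g]) (auto simp: \<phi>_def)
  have \<phi>h: "bij_betw \<phi> (B - A) ((?T - T1) \<union> ?S')"
    using h by (subst bij_betw_cong[of _ \<phi> h]) (auto simp: \<phi>_def)
  have "bij_betw \<phi> (A \<inter> B \<union> (A - B)) (T1 \<union> ((?T - T1) \<union> ?S))"
    by (rule bij_betw_combine[OF \<phi>f \<phi>g]) (use T1 le in auto)
  moreover have "A \<inter> B \<union> (A - B) = A" "T1 \<union> ((?T - T1) \<union> ?S) = ?S \<union> ?T" using T1 by auto
  ultimately have A: "inj_on \<phi> A" "\<phi> ` A = ?S \<union> ?T" by (auto simp: bij_betw_def)
  have "bij_betw \<phi> (A \<inter> B \<union> (B - A)) (T1 \<union> ((?T - T1) \<union> ?S'))"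
    by (rule bij_betw_combine[OF \<phi>f \<phi>h]) (use T1 in auto)
  moreover have "A \<inter> B \<union> (B - A) = B" "T1 \<union> ((?T - T1) \<union> ?S') = ?S' \<union> ?T" using T1 by auto
  ultimately have B: "inj_on \<phi> B" "\<phi> ` B = ?S' \<union> ?T" by (auto simp: bij_betw_def)
  let ?V = "\<lambda>s j. if j = \<phi> s then 1 else (0::'k)"
  have "contract ?T (\<Prod>s\<in>A. vec (n + t) (?V s)) = sq_term 1 ?S"
    using A le by (subst prod_vec_unit) (auto simp: fin intro!: contract_sq_term)
  moreover have "contract ?T (\<Prod>s\<in>B. vec (n + t) (?V s)) = sq_term 1 ?S'"
    using B le by (subst prod_vec_unit) (auto simp: fin intro!: contract_sq_term)
  moreover have "sq_term 1 ?S * sq_term 1 ?S' = (sq_term 1 {..<n} :: 'k sqfree)"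
    using le by (subst sq_term_times_sq_term) (auto simp: ivl_disj_un intro!: arg_cong[where f = "sq_term 1"])
  ultimately show ?thesis by (intro exI[of _ ?V]) (simp add: sq_coeff_sq_term)
qed

text \<open>Rational functions over the field with two elements provide both requirements on the
  scalars: infinitely many of them for general position, and characteristic 2.\<close>

lemma infinite_UNIV_bit_poly_fract: "infinite (UNIV :: bit poly fract set)"
proof -
  have "inj (\<lambda>n. monom (1::bit) n)" by (auto intro!: injI simp: monom_eq_iff')
  moreover have "inj (to_fract :: bit poly \<Rightarrow> _)" by (auto intro!: injI)
  ultimately have "inj (\<lambda>n. to_fract (monom (1::bit) n))" by (auto simp: inj_def)
  then show ?thesis using infinite_UNIV_nat finite_imageD finite_subset subset_UNIV by metis
qed

lemma char_2_bit_poly_fract: "(1 :: bit poly fract) + 1 = 0"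
proof -
  have "(1 :: bit poly) + 1 = 0" by (simp only: one_pCons add_pCons) simp
  then show ?thesis by (metis to_fract_0 to_fract_1 to_fract_add)
qed

theorem theorem1p5:
  fixes m t N :: nat
    and A B :: "nat \<Rightarrow> 'a set"
    and a b :: "nat \<Rightarrow> nat"
  assumes "m > 0"
    and "\<And>i. i \<in> {1..m} \<Longrightarrow> finite (A i)"
    and "\<And>i. i \<in> {1..m} \<Longrightarrow> finite (B i)"
    and "\<And>i. i \<in> {1..m} \<Longrightarrow> card (A i) = a i"
    and "\<And>i. i \<in> {1..m} \<Longrightarrow> card (B i) = b i"
    and "\<And>i. i \<in> {1..m} \<Longrightarrow> a i \<le> b i"
    and "\<And>i j. i \<in> {1..m} \<Longrightarrow> j \<in> {1..m} \<Longrightarrow> card (A i \<inter> A j) > t"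
    and "\<And>i. i \<in> {1..m} \<Longrightarrow> card (A i \<inter> B i) \<le> t"
    and "\<And>i j. i \<in> {1..m} \<Longrightarrow> j \<in> {1..m} \<Longrightarrow> i < j \<Longrightarrow> card (A i \<inter> B j) > t"
    and "N > 0"
    and "\<And>i. i \<in> {1..m} \<Longrightarrow> a i + b i = N"
    and "\<And>i j. i \<in> {1..m} \<Longrightarrow> j \<in> {1..m} \<Longrightarrow> i \<le> j \<Longrightarrow> a i \<le> a j"
  shows "(\<Sum>i=1..m. inverse (real ((N - (2 * t + 1)) choose (a i - (t + 1))))) \<le> 1"
proof -
  define n where "n = N - 2 * t"
  have t_less: "t < a i" if "i \<in> {1..m}" for i using assms(7)[OF that that] assms(4)[OF that] by simp
  have sizes: "t < a i \<and> a i \<le> b i \<and> a i + b i = n + 2 * t" if "i \<in> {1..m}" for i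
    using t_less[OF that] assms(6,11)[OF that] by (simp add: n_def)
  have n: "0 < n" using sizes[of 1] assms(1) by simp
  let ?prod = "\<lambda>(V :: 'a \<Rightarrow> nat \<Rightarrow> bit poly fract) C. contract {n..<n + t} (\<Prod>s\<in>C. vec (n + t) (V s))"
  have "\<exists>V. \<forall>i\<in>{1..m}. sq_coeff (?prod V (A i) * ?prod V (B i)) {..<n} \<noteq> 0"
  proof (rule exists_common_nonzero[OF infinite_UNIV_bit_poly_fract])
    fix i assume i: "i \<in> {1..m}"
    show "\<exists>V. sq_coeff (?prod V (A i) * ?prod V (B i)) {..<n} \<noteq> 0"
      by (rule exists_contract_prod_vec_nonzero) (use assms(2-5,8)[OF i] sizes[OF i] in auto)
    show "polynomial_fun (\<lambda>l. sq_coeff (?prod (\<lambda>s j. V s j + l * (W s j - V s j)) (A i) *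
      ?prod (\<lambda>s j. V s j + l * (W s j - V s j)) (B i)) {..<n})" for V W
      by (intro polynomial_fun_sq_coeff_times polynomial_fun_sq_coeff_contract
        polynomial_fun_sq_coeff_prod polynomial_fun_sq_coeff_vec polynomial_fun_line)
  qed simp
  then obtain V where V: "\<And>i. i \<in> {1..m} \<Longrightarrow> sq_coeff (?prod V (A i) * ?prod V (B i)) {..<n} \<noteq> 0"
    by blast
  have zero: "?prod V C * ?prod V D = 0" if "finite C" "finite D" "t < card (C \<inter> D)" for C D
    by (rule contract_prod_vec_times_eq_0[OF char_2_bit_poly_fract that])
  define w where "w i = ?prod V (A i)" for i
  define u where "u i = ?prod V (B i)" for i
  have hom: "homogeneous n (a i - t) (w i)" if "i \<in> {1..m}" for i
    using homogeneous_contract[OF homogeneous_prod[OF homogeneous_vec assms(2)[OF that]]] assms(4)[OF that]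
    by (simp add: w_def)
  have mono: "a i - t \<le> a j - t" if "i \<in> {1..m}" "j \<in> {1..m}" "i \<le> j" for i j
    using assms(12)[OF that] by simp
  have ww: "w i * w j = 0" if "i \<in> {1..m}" "j \<in> {1..m}" for i j
    unfolding w_def by (rule zero[OF assms(2)[OF that(1)] assms(2)[OF that(2)] assms(7)[OF that]])
  have wu: "w i * u j = 0" if "i \<in> {1..m}" "j \<in> {1..m}" "i < j" for i j
    unfolding w_def u_def by (rule zero[OF assms(2)[OF that(1)] assms(3)[OF that(2)] assms(9)[OF that]])
  have wu': "w i * u i \<noteq> 0" if "i \<in> {1..m}" for i
    using V[OF that] unfolding w_def u_def by (metis zero_sqfree.rep_eq)
  obtain S where S: "\<And>i. i \<in> {1..m} \<Longrightarrow> S i \<subseteq> {..<n} \<and> card (S i) = a i - t"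
    and meet: "\<And>i j. i \<in> {1..m} \<Longrightarrow> j \<in> {1..m} \<Longrightarrow> S i \<inter> S j \<noteq> {}"
    and antichain: "\<And>i j. i \<in> {1..m} \<Longrightarrow> j \<in> {1..m} \<Longrightarrow> S i \<subseteq> S j \<Longrightarrow> i = j"
    by (rule leading_monomials_intersecting_antichain[where k = "\<lambda>i. a i - t", OF hom mono ww wu wu'])
      (assumption | rule that)+
  have inj: "inj_on S {1..m}" using antichain by (auto intro: inj_onI)
  have "(\<Sum>i=1..m. inverse (real ((N - (2 * t + 1)) choose (a i - (t + 1))))) =
      (\<Sum>i=1..m. inverse (real ((card {..<n} - 1) choose (card (S i) - 1))))"
    using S by (intro sum.cong) (auto simp: n_def)
  also have "\<dots> = (\<Sum>T\<in>S ` {1..m}. inverse (real ((card {..<n} - 1) choose (card T - 1))))"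
    by (subst sum.reindex[OF inj]) simp
  also have "\<dots> \<le> 1"
  proof (rule intersecting_antichain_bound)
    show "S ` {1..m} \<subseteq> Pow {..<n}" using S by blast
  next
    fix T assume "T \<in> S ` {1..m}"
    then obtain i where i: "i \<in> {1..m}" "T = S i" by auto
    \<comment> \<open>From \<open>a i \<le> b i\<close> and \<open>a i + b i = n + 2 * t\<close>
      follows \<open>2 * (a i - t) \<le> n\<close>.\<close>
    show "2 * card T \<le> card {..<n}" using S[OF i(1)] sizes[OF i(1)] i(2) by auto
  next
    fix T U assume "T \<in> S ` {1..m}" "U \<in> S ` {1..m}"
    then obtain i j where ij: "i \<in> {1..m}" "j \<in> {1..m}" "T = S i" "U = S j" by auto
    show "T \<inter> U \<noteq> {}" using meet ij by auto
    show "T = U" if "T \<subseteq> U" using antichain[OF ij(1,2)] that ij by auto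
  qed (use n in auto)
  finally show ?thesis .
qed

end
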